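(* For every positive integer $k\ge 2$ there exist infinitely many Cayley graphs $X$ with Hamilton compression $\kappa(X)=k$.
   Context: Graphs are finite, simple and undirected, and "infinitely many" is understood up to isomorphism. Hamilton compression: let $X$ be a graph of order $N$. A Hamilton cycle $C=v_0,v_1,\ldots,v_{N-1},v_0$ in $X$ is $\ell$-symmetric (where $\ell$ is a positive divisor of $N$) if there exists an automorphism $\alpha$ of $X$ such that $\alpha(v_i)=v_{i+N/\ell}$ for each $i\in\mathbb{Z}_N$. The compression factor $\kappa(X,C)$ is the maximum $\ell$ for which $C$ is $\ell$-symmetric. The Hamilton compression is $\kappa(X)=\max\{\kappa(X,C)\mid C \text{ is a Hamilton cycle in } X\}$, and $\kappa(X)=0$ if $X$ has no Hamilton cycle. *)

theory Defs
  imports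
    "HOL-Algebra.Group"
    "Graph_Theory.Pair_Digraph"
    "Graph_Theory.Digraph_Isomorphism"
begin

text \<open>A finite simple undirected graph is a \<^locale>\<open>pair_graph\<close>: finite, loop-free, and with a
  symmetric arc set, so that the edge \<open>uv\<close> is the pair of arcs \<open>(u,v)\<close>, \<open>(v,u)\<close>.\<close>

definition cayley_graph_of :: "('a, 'b) monoid_scheme \<Rightarrow> 'a set \<Rightarrow> 'a pair_pre_digraph" where
  "cayley_graph_of G S =
     \<lparr> pverts = carrier G, parcs = {(g, g \<otimes>\<^bsub>G\<^esub> s) | g s. g \<in> carrier G \<and> s \<in> S} \<rparr>"

definition is_cayley_graph :: "'a pair_pre_digraph \<Rightarrow> bool" where
  "is_cayley_graph X \<longleftrightarrow>
     (\<exists>(G :: 'a monoid) S. group G \<and> finite (carrier G) \<and>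
        S \<subseteq> carrier G - {\<one>\<^bsub>G\<^esub>} \<and> (\<forall>s\<in>S. inv\<^bsub>G\<^esub> s \<in> S) \<and>
        X = cayley_graph_of G S)"

lemma is_cayley_graph_imp_pair_graph:
  assumes "is_cayley_graph X"
  shows "pair_graph X"
proof -
  obtain G :: "'a monoid" and S where G: "group G" "finite (carrier G)"
    and S: "S \<subseteq> carrier G - {\<one>\<^bsub>G\<^esub>}" "\<forall>s\<in>S. inv\<^bsub>G\<^esub> s \<in> S"
    and X: "X = cayley_graph_of G S"
    using assms unfolding is_cayley_graph_def by blast
  interpret group G by fact
  have wf: "parcs X \<subseteq> pverts X \<times> pverts X"
    using S by (auto simp: X cayley_graph_of_def)
  have sym: "(v, u) \<in> parcs X" if "(u, v) \<in> parcs X" for u v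
  proof -
    from that obtain s where s: "u \<in> carrier G" "s \<in> S" "v = u \<otimes>\<^bsub>G\<^esub> s"
      by (auto simp: X cayley_graph_of_def)
    then have "s \<in> carrier G" using S by auto
    then have "v \<in> carrier G" "v \<otimes>\<^bsub>G\<^esub> inv\<^bsub>G\<^esub> s = u"
      using s by (simp_all add: m_assoc)
    moreover have "inv\<^bsub>G\<^esub> s \<in> S" using s S by blast
    ultimately show ?thesis unfolding X cayley_graph_of_def by force
  qed
  have loopfree: "(u, u) \<notin> parcs X" for u
  proof
    assume "(u, u) \<in> parcs X"
    then obtain s where s: "u \<in> carrier G" "s \<in> S" "u = u \<otimes>\<^bsub>G\<^esub> s"
      by (auto simp: X cayley_graph_of_def)
    then have "s \<in> carrier G" using S by blast
    then have "s = \<one>\<^bsub>G\<^esub>" using s(1) s(3)[symmetric] by simp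
    then show False using s(2) S by blast
  qed
  have fin: "finite (pverts X)" using G by (simp add: X cayley_graph_of_def)
  then have "finite (parcs X)" using wf by (meson finite_SigmaI finite_subset)
  with fin show ?thesis
    by unfold_locales (use wf sym loopfree in \<open>auto simp: symmetric_def intro!: symI\<close>)
qed

definition graph_automorphism :: "'a pair_pre_digraph \<Rightarrow> ('a \<Rightarrow> 'a) \<Rightarrow> bool" where
  "graph_automorphism X \<alpha> \<longleftrightarrow>
     bij_betw \<alpha> (pverts X) (pverts X) \<and>
     (\<forall>u\<in>pverts X. \<forall>v\<in>pverts X. (\<alpha> u, \<alpha> v) \<in> parcs X \<longleftrightarrow> (u, v) \<in> parcs X)"

text \<open>A Hamilton cycle \<open>v\<^sub>0, \<dots>, v\<^sub>N\<^sub>-\<^sub>1, v\<^sub>0\<close> is given by the list of its \<open>N\<close> distinct vertices;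
  indices are read modulo \<open>N\<close>.\<close>

definition hamilton_cycle :: "'a pair_pre_digraph \<Rightarrow> 'a list \<Rightarrow> bool" where
  "hamilton_cycle X C \<longleftrightarrow>
     distinct C \<and> set C = pverts X \<and> 3 \<le> length C \<and>
     (\<forall>i<length C. (C ! i, C ! ((i + 1) mod length C)) \<in> parcs X)"

definition symmetric_cycle :: "'a pair_pre_digraph \<Rightarrow> 'a list \<Rightarrow> nat \<Rightarrow> bool" where
  "symmetric_cycle X C l \<longleftrightarrow>
     0 < l \<and> l dvd length C \<and>
     (\<exists>\<alpha>. graph_automorphism X \<alpha> \<and>
        (\<forall>i<length C. \<alpha> (C ! i) = C ! ((i + length C div l) mod length C)))"

definition compression_factor :: "'a pair_pre_digraph \<Rightarrow> 'a list \<Rightarrow> nat" where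
  "compression_factor X C = Max {l. symmetric_cycle X C l}"

definition hamilton_compression :: "'a pair_pre_digraph \<Rightarrow> nat" where
  "hamilton_compression X =
     (if \<exists>C. hamilton_cycle X C
      then Max {compression_factor X C | C. hamilton_cycle X C}
      else 0)"

text \<open>Both maxima are taken over finite nonempty sets.\<close>

lemma symmetric_cycle_one:
  assumes "hamilton_cycle X C"
  shows "symmetric_cycle X C 1"
  unfolding symmetric_cycle_def graph_automorphism_def
  by (auto intro!: exI[of _ id])

lemma finite_symmetric_cycle:
  assumes "hamilton_cycle X C"
  shows "finite {l. symmetric_cycle X C l}"
proof (rule finite_subset)
  show "{l. symmetric_cycle X C l} \<subseteq> {..length C}"
    using assms by (auto simp: symmetric_cycle_def hamilton_cycle_def intro!: dvd_imp_le)
qed simp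

lemma finite_compression_factors:
  "finite {compression_factor X C | C. hamilton_cycle X C}"
proof -
  have "compression_factor X C \<le> card (pverts X)" if "hamilton_cycle X C" for C
  proof -
    have "compression_factor X C \<in> {l. symmetric_cycle X C l}"
      unfolding compression_factor_def
      using symmetric_cycle_one[OF that] finite_symmetric_cycle[OF that] by (intro Max_in) auto
    then have "compression_factor X C \<le> length C"
      using that by (auto simp: symmetric_cycle_def hamilton_cycle_def intro!: dvd_imp_le)
    also have "length C = card (pverts X)"
      using that by (metis distinct_card hamilton_cycle_def)
    finally show ?thesis .
  qed
  then have "{compression_factor X C | C. hamilton_cycle X C} \<subseteq> {..card (pverts X)}" by auto
  then show ?thesis using finite_subset by blast
qed

text \<open>The library's \<^const>\<open>digraph_iso\<close> carries separate maps on vertices, arcs and arc ends; on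
  graphs without parallel arcs it amounts to a bijection of the vertices preserving adjacency
  and non-adjacency.\<close>

lemma digraph_iso_with_proj_iff:
  assumes "pair_graph X" "pair_graph Y"
  shows "digraph_iso (with_proj X) (with_proj Y) \<longleftrightarrow>
    (\<exists>\<alpha>. bij_betw \<alpha> (pverts X) (pverts Y) \<and>
      (\<forall>u\<in>pverts X. \<forall>v\<in>pverts X. (\<alpha> u, \<alpha> v) \<in> parcs Y \<longleftrightarrow> (u, v) \<in> parcs X))"
    (is "?L \<longleftrightarrow> ?R")
proof
  interpret X: pair_graph X by fact
  assume ?L
  then obtain f where f: "pre_digraph.digraph_isomorphism (with_proj X) f"
    and Y: "with_proj Y = app_iso f (with_proj X)"
    unfolding digraph_iso_def by blast
  have V: "pverts Y = iso_verts f ` pverts X" and A: "parcs Y = iso_arcs f ` parcs X"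
    and T: "iso_tail f = fst" and H: "iso_head f = snd"
    using Y by (auto simp: with_proj_def app_iso_def)
  have inj: "inj_on (iso_verts f) (pverts X)"
    and ends: "\<And>a. a \<in> parcs X \<Longrightarrow> iso_arcs f a = (iso_verts f (fst a), iso_verts f (snd a))"
    using f by (auto simp: pre_digraph.digraph_isomorphism_def T H prod_eq_iff)
  have "(iso_verts f u, iso_verts f v) \<in> parcs Y \<longleftrightarrow> (u, v) \<in> parcs X"
    if uv: "u \<in> pverts X" "v \<in> pverts X" for u v
  proof
    assume "(u, v) \<in> parcs X"
    then show "(iso_verts f u, iso_verts f v) \<in> parcs Y"
      using ends unfolding A by (metis fst_conv imageI snd_conv)
  next
    assume "(iso_verts f u, iso_verts f v) \<in> parcs Y"
    then obtain x y where xy: "(x, y) \<in> parcs X"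
      "(iso_verts f u, iso_verts f v) = iso_arcs f (x, y)"
      unfolding A by auto
    then have "x \<in> pverts X" "y \<in> pverts X"
      using X.wellformed' by auto
    then have "x = u" "y = v"
      using xy ends[OF xy(1)] uv inj by (auto dest: inj_onD)
    then show "(u, v) \<in> parcs X" using xy by simp
  qed
  then show ?R using V inj by (intro exI[of _ "iso_verts f"]) (auto simp: bij_betw_def)
next
  interpret X: pair_graph X by fact
  interpret Y: pair_graph Y by fact
  assume ?R
  then obtain \<alpha> where \<alpha>: "bij_betw \<alpha> (pverts X) (pverts Y)"
    and adj: "\<And>u v. u \<in> pverts X \<Longrightarrow> v \<in> pverts X \<Longrightarrow> (\<alpha> u, \<alpha> v) \<in> parcs Y \<longleftrightarrow> (u, v) \<in> parcs X"
    by blast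
  have inj: "inj_on \<alpha> (pverts X)" and im: "\<alpha> ` pverts X = pverts Y"
    using \<alpha> by (auto simp: bij_betw_def)
  define f :: "('a, 'a \<times> 'a, 'b, 'b \<times> 'b) digraph_isomorphism" where
    "f = \<lparr> iso_verts = \<alpha>, iso_arcs = map_prod \<alpha> \<alpha>, iso_head = snd, iso_tail = fst \<rparr>"
  have sub: "parcs X \<subseteq> pverts X \<times> pverts X" using X.wellformed' by auto
  have "inj_on (map_prod \<alpha> \<alpha>) (parcs X)"
    using map_prod_inj_on[OF inj inj] sub by (rule inj_on_subset)
  then have iso: "pre_digraph.digraph_isomorphism (with_proj X) f"
    unfolding pre_digraph.digraph_isomorphism_def using inj X.wf_digraph by (simp add: f_def)
  have "map_prod \<alpha> \<alpha> ` parcs X = parcs Y"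
  proof (intro equalityI subsetI)
    fix e assume "e \<in> map_prod \<alpha> \<alpha> ` parcs X"
    then show "e \<in> parcs Y" using adj sub by auto
  next
    fix e assume e: "e \<in> parcs Y"
    obtain p q where pq: "e = (p, q)" by (cases e)
    then have "p \<in> \<alpha> ` pverts X" "q \<in> \<alpha> ` pverts X"
      using e Y.wellformed' im by auto
    then obtain u v where "u \<in> pverts X" "v \<in> pverts X" "p = \<alpha> u" "q = \<alpha> v" by auto
    then show "e \<in> map_prod \<alpha> \<alpha> ` parcs X" using adj e pq by force
  qed
  then have "with_proj Y = app_iso f (with_proj X)"
    using im by (simp add: with_proj_def app_iso_def f_def)
  with iso show ?L unfolding digraph_iso_def by blast
qed

end

theory Submission
  imports Defs "HOL-Number_Theory.Cong"
begin

text \<open>Take a prime \<open>p > k\<close> and let \<open>X\<close> be the \<open>k \<times> p\<close> rook's graph: the vertices are the cells of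
  a board with \<open>k\<close> rows of \<open>p\<close> cells each, and two cells are adjacent when they share a row or a
  column. Since \<open>k\<close> and \<open>p\<close> are coprime, the Chinese remainder theorem identifies the board with
  the integers modulo \<open>k p\<close>, so \<open>X\<close> is a Cayley graph of a cyclic group. Its compression is exactly
  \<open>k\<close>, and the infinitely many primes above \<open>k\<close> give graphs of different orders.

  \<^emph>\<open>At most \<open>k\<close>.\<close> A divisor of \<open>k p\<close> larger than \<open>k\<close> is a multiple of \<open>p\<close>, so a Hamilton cycle
  whose compression exceeds \<open>k\<close> is mapped to itself, shifted by \<open>k\<close> positions, by some automorphism
  of order \<open>p\<close>. As \<open>k < p\<close>, the rows are the only cliques of their size, so the automorphism
  permutes the \<open>k\<close> rows (\<open>graph_automorphism_preserves_rows\<close>). A permutation of order \<open>p\<close> has only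
  trivial orbits on fewer than \<open>p\<close> points (\<open>prime_periodic_orbit_constant\<close>), so each row is fixed.
  Hence the row visited by the cycle depends only on the position modulo \<open>k\<close>, and as all \<open>k\<close> rows
  are visited, consecutive vertices always lie in different rows. They must then share a
  column, and the whole cycle stays in one column, which is absurd
  (\<open>symmetric_cycle_rook_graph_le\<close>).

  \<^emph>\<open>At least \<open>k\<close>.\<close> Let \<open>\<sigma>\<close> be a permutation of the columns with \<open>\<sigma>\<^sup>k = 1\<close> and \<open>\<sigma> 0 = 1\<close>. Moving to
  the next row while applying \<open>\<sigma>\<close> to the column is an automorphism. Start with a path through all
  of row 0 from column 0 to column 1; its image starts in row 1 at column \<open>\<sigma> 0 = 1\<close>, right below the
  end of the path. So the \<open>k\<close> images of the path close up to a Hamilton cycle, rotated by the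
  automorphism (\<open>rook_graph_symmetric_hamilton_cycle\<close>).\<close>

lemma coprime_less_prime:
  fixes a p :: nat
  assumes "prime p" "0 < a" "a < p"
  shows "coprime a p"
  using assms by (metis coprime_commute nat_dvd_not_less prime_imp_coprime)

section \<open>Rook's graphs as Cayley graphs of cyclic groups\<close>

text \<open>The row of a vertex is its residue modulo \<open>k\<close>, its column the residue modulo \<open>p\<close>. This numbering
  of the cells describes the \<open>k \<times> p\<close> board only for coprime \<open>k\<close> and \<open>p\<close>; it makes the graph
  visibly invariant under translations modulo \<open>k p\<close>.\<close>

definition rook_graph :: "nat \<Rightarrow> nat \<Rightarrow> nat pair_pre_digraph" where
  "rook_graph k p =
     \<lparr> pverts = {..<k * p},
       parcs = {(u, v). u < k * p \<and> v < k * p \<and> u \<noteq> v \<and> (u mod k = v mod k \<or> u mod p = v mod p)} \<rparr>"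

lemma pverts_rook_graph [simp]: "pverts (rook_graph k p) = {..<k * p}"
  by (simp add: rook_graph_def)

lemma parcs_rook_graph [simp]:
  "(u, v) \<in> parcs (rook_graph k p) \<longleftrightarrow>
     u < k * p \<and> v < k * p \<and> u \<noteq> v \<and> (u mod k = v mod k \<or> u mod p = v mod p)"
  by (simp add: rook_graph_def)

lemma same_row_and_column_imp_eq:
  fixes u v :: nat
  assumes "coprime k p" "u < k * p" "v < k * p" "u mod k = v mod k" "u mod p = v mod p"
  shows "u = v"
  using coprime_cong_mult_nat[of u v k p] assms by (simp add: cong_def)

definition cyclic_monoid :: "nat \<Rightarrow> nat monoid" where
  "cyclic_monoid n = \<lparr> carrier = {..<n}, monoid.mult = (\<lambda>a b. (a + b) mod n), one = 0 \<rparr>"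

lemma cyclic_monoid_simps [simp]:
  "carrier (cyclic_monoid n) = {..<n}"
  "a \<otimes>\<^bsub>cyclic_monoid n\<^esub> b = (a + b) mod n"
  "\<one>\<^bsub>cyclic_monoid n\<^esub> = 0"
  by (simp_all add: cyclic_monoid_def)

lemma group_cyclic_monoid:
  assumes "0 < n"
  shows "group (cyclic_monoid n)"
proof (rule groupI)
  fix a assume "a \<in> carrier (cyclic_monoid n)"
  then show "\<exists>b\<in>carrier (cyclic_monoid n). b \<otimes>\<^bsub>cyclic_monoid n\<^esub> a = \<one>\<^bsub>cyclic_monoid n\<^esub>"
    using assms by (intro bexI[of _ "(n - a) mod n"]) (auto simp: mod_simps)
qed (use assms in \<open>auto simp: mod_simps add.assoc\<close>)

lemma inv_cyclic_monoid:
  assumes "0 < n" "a < n"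
  shows "inv\<^bsub>cyclic_monoid n\<^esub> a = (n - a) mod n"
proof -
  interpret group "cyclic_monoid n" using assms by (intro group_cyclic_monoid)
  show ?thesis using assms by (intro inv_equality) (auto simp: mod_simps)
qed

lemma is_cayley_graph_rook_graph:
  assumes "0 < k" "0 < p"
  shows "is_cayley_graph (rook_graph k p)"
proof -
  define n where "n = k * p"
  define S where "S = {s. 0 < s \<and> s < n \<and> (k dvd s \<or> p dvd s)}"
  have n: "0 < n" "k dvd n" "p dvd n" using assms by (auto simp: n_def)
  have arcs: "(u, v) \<in> parcs (rook_graph k p) \<longleftrightarrow>
      (\<exists>g s. u = g \<and> v = (g + s) mod n \<and> g < n \<and> s \<in> S)" for u v
  proof
    assume uv: "(u, v) \<in> parcs (rook_graph k p)"
    then have lt: "u < n" "v < n" "u \<noteq> v" by (auto simp: n_def)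
    define s where "s = (v + (n - u)) mod n"
    have eq: "(u + s) mod n = v" using lt by (simp add: s_def mod_simps)
    have dvd: "q dvd s" if "u mod q = v mod q" "q dvd n" for q
    proof -
      have "(u + s) mod q = u mod q" using eq that by (metis mod_mod_cancel)
      then show ?thesis
        by (metis add.right_neutral cong_add_lcancel_nat cong_def dvd_eq_mod_eq_0 mod_0)
    qed
    have "s \<in> S" using uv eq lt n dvd[of k] dvd[of p]
      by (cases "s = 0") (auto simp: S_def s_def)
    then show "\<exists>g s. u = g \<and> v = (g + s) mod n \<and> g < n \<and> s \<in> S" using eq lt by blast
  next
    assume "\<exists>g s. u = g \<and> v = (g + s) mod n \<and> g < n \<and> s \<in> S"
    then obtain s where s: "v = (u + s) mod n" "u < n" "s \<in> S" by blast
    have "u \<noteq> v"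
    proof
      assume "u = v"
      then have "[u + s = u + 0] (mod n)" using s by (simp add: cong_def)
      then have "n dvd s" unfolding cong_add_lcancel_nat by (simp add: cong_0_iff)
      then show False using s by (auto simp: S_def dest: dvd_imp_le)
    qed
    moreover have "v mod q = u mod q" if "q dvd s" "q dvd n" for q
      using that s(1) by (auto simp: mod_mod_cancel elim!: dvdE)
    ultimately show "(u, v) \<in> parcs (rook_graph k p)"
      using s n by (auto simp: S_def n_def[symmetric])
  qed
  have inv: "inv\<^bsub>cyclic_monoid n\<^esub> s \<in> S" if "s \<in> S" for s
    using that n by (auto simp: inv_cyclic_monoid S_def)
  have "rook_graph k p = cayley_graph_of (cyclic_monoid n) S"
  proof -
    have "parcs (rook_graph k p) = {(g, (g + s) mod n) | g s. g < n \<and> s \<in> S}"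
      by (simp add: set_eq_iff arcs del: parcs_rook_graph)
    then show ?thesis
      unfolding cayley_graph_of_def
      by (intro pair_pre_digraph.equality) (auto simp: n_def)
  qed
  then show ?thesis
    unfolding is_cayley_graph_def using group_cyclic_monoid[OF n(1)] inv
    by (intro exI[of _ "cyclic_monoid n"] exI[of _ S]) (auto simp: S_def)
qed

section \<open>Rotations of order divisible by the prime\<close>

lemma card_row:
  fixes k p j :: nat
  assumes "j < k"
  shows "card {x. x < k * p \<and> x mod k = j} = p"
proof -
  have "{x. x < k * p \<and> x mod k = j} = (\<lambda>q. k * q + j) ` {..<p}"
  proof (intro equalityI subsetI)
    fix x assume x: "x \<in> {x. x < k * p \<and> x mod k = j}"
    then have "x = k * (x div k) + j" "x div k < p"
      by (auto simp: less_mult_imp_div_less mult.commute)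
    then show "x \<in> (\<lambda>q. k * q + j) ` {..<p}" by blast
  next
    fix x assume "x \<in> (\<lambda>q. k * q + j) ` {..<p}"
    then obtain q where q: "q < p" "x = k * q + j" by auto
    have "k * q + j < k * Suc q" using assms by simp
    also have "\<dots> \<le> k * p" using q by (intro mult_le_mono2) simp
    finally show "x \<in> {x. x < k * p \<and> x mod k = j}" using q assms by simp
  qed
  moreover have "inj_on (\<lambda>q. k * q + j) {..<p}" using assms by (auto simp: inj_on_def)
  ultimately show ?thesis by (simp add: card_image)
qed

text \<open>Two cells in different rows of a clique share a column, and every further cell adjacent to both
  must lie in that column too. So a clique not contained in a row is contained in a column,
  which has only \<open>k\<close> cells.\<close>

lemma large_clique_in_row:
  assumes "coprime k p" "0 < k"
    and B: "B \<subseteq> {..<k * p}" "k < card B"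
    and clique: "\<And>x y. x \<in> B \<Longrightarrow> y \<in> B \<Longrightarrow> x \<noteq> y \<Longrightarrow> (x, y) \<in> parcs (rook_graph k p)"
    and xy: "x \<in> B" "y \<in> B"
  shows "x mod k = y mod k"
proof (rule ccontr)
  assume neq: "x mod k \<noteq> y mod k"
  then have "x \<noteq> y" by blast
  then have col: "z mod p = x mod p" if "z \<in> B" for z
    using clique[OF xy] clique[OF xy(1) that] clique[OF xy(2) that] neq
    by (cases "z = x"; cases "z = y") auto
  have "inj_on (\<lambda>z. z mod k) B"
    using col B same_row_and_column_imp_eq[OF assms(1)] by (intro inj_onI) (auto simp: subset_iff)
  then have "card B \<le> card {..<k}"
    using assms(2) by (intro card_inj_on_le) auto
  then show False using B by simp
qed

text \<open>The image of a row is a clique of \<open>p > k\<close> vertices, hence again contained in a row.\<close>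

lemma graph_automorphism_preserves_rows:
  assumes "coprime k p" "0 < k" "k < p" "graph_automorphism (rook_graph k p) \<alpha>"
    and uw: "u < k * p" "w < k * p" "u mod k = w mod k"
  shows "\<alpha> u mod k = \<alpha> w mod k"
proof -
  define A where "A = {x. x < k * p \<and> x mod k = u mod k}"
  have bij: "bij_betw \<alpha> {..<k * p} {..<k * p}"
    and adj: "\<And>x y. x < k * p \<Longrightarrow> y < k * p \<Longrightarrow>
      (\<alpha> x, \<alpha> y) \<in> parcs (rook_graph k p) \<longleftrightarrow> (x, y) \<in> parcs (rook_graph k p)"
    using assms(4) unfolding graph_automorphism_def by auto
  have A: "A \<subseteq> {..<k * p}" by (auto simp: A_def)
  show ?thesis
  proof (rule large_clique_in_row[OF assms(1,2), of "\<alpha> ` A"])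
    show "\<alpha> ` A \<subseteq> {..<k * p}" using bij A by (auto simp: bij_betw_def)
    have "inj_on \<alpha> A" using bij A by (auto simp: bij_betw_def intro: inj_on_subset)
    then have "card (\<alpha> ` A) = card A" by (rule card_image)
    also have "card A = p" unfolding A_def using assms(2) by (intro card_row) simp
    finally show "k < card (\<alpha> ` A)" using assms(3) by simp
    show "(x, y) \<in> parcs (rook_graph k p)" if "x \<in> \<alpha> ` A" "y \<in> \<alpha> ` A" "x \<noteq> y" for x y
    proof -
      obtain x' y' where x': "x = \<alpha> x'" "x' \<in> A" and y': "y = \<alpha> y'" "y' \<in> A"
        using \<open>x \<in> \<alpha> ` A\<close> \<open>y \<in> \<alpha> ` A\<close> by (elim imageE) blast
      then have "(x', y') \<in> parcs (rook_graph k p)" using that by (auto simp: A_def)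
      then show ?thesis using adj[of x' y'] x' y' A by blast
    qed
  qed (use uw in \<open>auto simp: A_def\<close>)
qed

text \<open>The hypothesis \<open>step\<close> says that \<open>s\<close> is an orbit of some map. With fewer than \<open>p\<close> values it has a
  period \<open>e < p\<close> besides the period \<open>p\<close>; these are coprime, so \<open>1\<close> is a period as well.\<close>

lemma prime_periodic_orbit_constant:
  fixes s :: "nat \<Rightarrow> nat"
  assumes "prime p" "k < p"
    and per: "\<And>j. s (j + p) = s j"
    and step: "\<And>i j. s i = s j \<Longrightarrow> s (Suc i) = s (Suc j)"
    and range: "\<And>j. s j < k"
  shows "s (Suc j) = s j"
proof -
  have "\<not> inj_on s {..k}"
  proof
    assume "inj_on s {..k}"
    then have "card {..k} \<le> card {..<k}" using range by (intro card_inj_on_le) auto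
    then show False by simp
  qed
  then obtain a b where ab: "s a = s b" "a < b" "b \<le> k"
    unfolding inj_on_def by (metis atMost_iff linorder_neqE_nat)
  define e where "e = b - a"
  have e: "0 < e" "e < p" "b = a + e" using ab assms by (auto simp: e_def)
  have shift: "s (a + n + e) = s (a + n)" for n
  proof (induction n)
    case 0 then show ?case using ab e by simp
  next
    case (Suc n)
    then show ?case using step[of "a + n + e" "a + n"] by simp
  qed
  have shift_many: "s (a + n + e * m) = s (a + n)" for n m
  proof (induction m)
    case (Suc m)
    then show ?case using shift[of "n + e * m"] by (simp add: algebra_simps)
  qed simp
  have per_many: "s (n + p * m) = s n" for n m
  proof (induction m)
    case (Suc m)
    then show ?case using per[of "n + p * m"] by (simp add: algebra_simps)
  qed simp
  have "coprime e p" using e assms(1) by (intro coprime_less_prime)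
  then obtain x y where xy: "e * x = p * y + 1"
    using bezout_nat[of e p] e by (auto simp: coprime_iff_gcd_eq_1)
  have pa: "j + p * a = a + (j + (p - 1) * a)"
    using e by (cases p) (auto simp: algebra_simps)
  have "s j = s (j + p * a)" by (simp add: per_many)
  also have "\<dots> = s (j + p * a + e * x)" using shift_many[of "j + (p - 1) * a" x] by (simp only: pa)
  also have "j + p * a + e * x = Suc j + p * (a + y)" by (simp add: xy algebra_simps)
  also have "s \<dots> = s (Suc j)" by (rule per_many)
  finally show ?thesis by simp
qed

lemma symmetric_cycle_rook_graph_le:
  assumes p: "prime p" "k < p" and k: "2 \<le> k"
    and C: "hamilton_cycle (rook_graph k p) C"
    and sym: "symmetric_cycle (rook_graph k p) C l"
  shows "l \<le> k"
proof (rule ccontr)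
  assume "\<not> l \<le> k"
  define N where "N = k * p"
  have cop: "coprime k p" using p k by (intro coprime_less_prime) auto
  have setC: "set C = {..<N}" and dist: "distinct C"
    and arc: "\<And>i. i < length C \<Longrightarrow> (C ! i, C ! ((i + 1) mod length C)) \<in> parcs (rook_graph k p)"
    using C unfolding hamilton_cycle_def N_def by auto
  have len: "length C = N" using distinct_card[OF dist] setC by simp
  have N0: "0 < N" using p k by (simp add: N_def)
  obtain \<alpha> where aut: "graph_automorphism (rook_graph k p) \<alpha>"
    and rot: "\<And>i. i < N \<Longrightarrow> \<alpha> (C ! i) = C ! ((i + N div l) mod N)"
    and l: "0 < l" "l dvd k * p"
    using sym unfolding symmetric_cycle_def len by (auto simp: N_def)
  have "p dvd l"
  proof (rule ccontr)
    assume "\<not> p dvd l"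
    then have "coprime l p" using p by (metis coprime_commute prime_imp_coprime)
    then have "l dvd k" using l by (simp add: coprime_dvd_mult_left_iff)
    then show False using \<open>\<not> l \<le> k\<close> k by (auto dest: dvd_imp_le)
  qed
  then obtain m where m: "l = p * m" by (auto elim: dvdE)
  \<comment> \<open>The shift \<open>d\<close> by which \<open>\<alpha>\<close> acts divides \<open>k\<close>, so the shift by \<open>k\<close> is the action of \<open>\<alpha>\<close> iterated \<open>m\<close> times.\<close>
  define d where "d = N div l"
  have "N = l * d" using l by (simp add: d_def N_def)
  then have kd: "k = d * m" using m p by (auto simp: N_def)
  define v where "v t = C ! (t mod N)" for t
  define row where "row t = v t mod k" for t
  have v_in: "v t < k * p" for t
    using setC len N0 nth_mem[of "t mod N" C] by (auto simp: v_def N_def)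
  have v_surj: "\<exists>t. v t = x" if "x < N" for x
  proof -
    have "x \<in> set C" using that setC by simp
    then obtain t where "t < N" "C ! t = x" unfolding in_set_conv_nth len by blast
    then show ?thesis by (intro exI[of _ t]) (simp add: v_def)
  qed
  have v_per: "v (t + N) = v t" for t by (simp add: v_def)
  have v_rot: "\<alpha> (v t) = v (t + d)" for t
    using rot[of "t mod N"] N0 by (simp add: v_def d_def mod_simps)
  have row_d: "row (s + d) = row (t + d)" if "row s = row t" for s t
  proof -
    have "\<alpha> (v s) mod k = \<alpha> (v t) mod k"
      using graph_automorphism_preserves_rows[OF cop _ p(2) aut v_in v_in, of s t] that k
      by (simp add: row_def)
    then show ?thesis by (simp add: row_def v_rot)
  qed
  have row_dj: "row (s + d * j) = row (t + d * j)" if "row s = row t" for s t j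
    using that
  proof (induction j)
    case (Suc j)
    then show ?case using row_d[of "s + d * j" "t + d * j"] by (simp add: algebra_simps)
  qed simp
  \<comment> \<open>Along the positions \<open>t, t + k, t + 2k, \<dots>\<close> the row runs through one orbit on the \<open>k\<close> rows,
    and returns after \<open>p\<close> steps.\<close>
  have row_k: "row (t + k) = row t" for t
  proof -
    have "row (t + k * Suc 0) = row (t + k * 0)"
    proof (rule prime_periodic_orbit_constant[OF p, of "\<lambda>j. row (t + k * j)"])
      show "row (t + k * (j + p)) = row (t + k * j)" for j
        using v_per[of "t + k * j"] by (simp add: row_def N_def algebra_simps)
      show "row (t + k * Suc i) = row (t + k * Suc j)" if "row (t + k * i) = row (t + k * j)" for i j
        using row_dj[OF that, of m] by (simp add: kd algebra_simps)
      show "row (t + k * j) < k" for j using k by (simp add: row_def)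
    qed
    then show ?thesis by simp
  qed
  have row_kj: "row (t + k * j) = row t" for t j
  proof (induction j)
    case (Suc j)
    then show ?case using row_k[of "t + k * j"] by (simp add: algebra_simps)
  qed simp
  have row_mod: "row t = row (t mod k)" for t
    using row_kj[of "t mod k" "t div k"] by simp
  \<comment> \<open>The first \<open>k\<close> positions already show every row, hence show each row once.\<close>
  have "{..<k} \<subseteq> row ` {..<k}"
  proof
    fix j assume j: "j \<in> {..<k}"
    have "k * 1 \<le> k * p" using p by (intro mult_le_mono2) simp
    then have "j < N" using j unfolding N_def by (metis lessThan_iff less_le_trans mult.right_neutral)
    then obtain t where "v t = j" using v_surj by blast
    then have "row (t mod k) = j" using j row_mod[of t] by (simp add: row_def)
    then show "j \<in> row ` {..<k}" using k by (intro image_eqI[of _ _ "t mod k"]) auto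
  qed
  moreover have "row ` {..<k} \<subseteq> {..<k}" using k by (auto simp: row_def)
  ultimately have "row ` {..<k} = {..<k}" by (intro equalityI)
  then have inj: "inj_on row {..<k}" by (intro eq_card_imp_inj_on) auto
  have col: "v (Suc t) mod p = v t mod p" for t
  proof -
    have "row (Suc t) \<noteq> row t"
    proof
      assume "row (Suc t) = row t"
      then have "Suc t mod k = t mod k"
        using inj k row_mod[of t] row_mod[of "Suc t"] by (auto dest!: inj_onD)
      then show False using k by (simp add: mod_Suc split: if_splits)
    qed
    moreover have "(v t, v (Suc t)) \<in> parcs (rook_graph k p)"
      using arc[of "t mod N"] N0 len by (simp add: v_def mod_simps)
    ultimately show ?thesis by (auto simp: row_def)
  qed
  have col0: "v t mod p = v 0 mod p" for t
    by (induction t) (simp_all add: col)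
  have "2 * 2 \<le> N" unfolding N_def using k p by (intro mult_le_mono) auto
  then obtain t0 t1 where "v t0 = 0" "v t1 = 1" using v_surj[of 0] v_surj[of 1] by auto
  then show False using col0[of t0] col0[of t1] p prime_gt_1_nat[OF p(1)] by simp
qed

section \<open>A Hamilton cycle with a rotation of order \<open>k\<close>\<close>

text \<open>This is the \<open>i\<close>-th power of the cyclic permutation \<open>(0 1 \<dots> k - 1)\<close> of the columns, which fixes
  the columns from \<open>k\<close> on.\<close>

definition twist :: "nat \<Rightarrow> nat \<Rightarrow> nat \<Rightarrow> nat" where
  "twist k i y = (if y < k then (y + i) mod k else y)"

lemma twist_inj:
  assumes "twist k i y = twist k i y'"
  shows "y = y'"
proof (cases "y < k \<and> y' < k")
  case True
  then have "[y + i = y' + i] (mod k)" using assms by (simp add: twist_def cong_def)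
  then show ?thesis using True unfolding cong_add_rcancel_nat by (simp add: cong_def)
next
  case False
  then show ?thesis
    using assms mod_less_divisor[of k "y + i"] mod_less_divisor[of k "y' + i"]
    by (auto simp: twist_def split: if_splits)
qed

lemma twist_less: "k < p \<Longrightarrow> y < p \<Longrightarrow> twist k i y < p"
  using mod_less_divisor[of k "y + i"] by (fastforce simp: twist_def)

lemma twist_add: "0 < k \<Longrightarrow> twist k (i + j) y = twist k i (twist k j y)"
  by (auto simp: twist_def mod_simps algebra_simps)

lemma twist_mod: "twist k (i mod k) y = twist k i y"
  by (auto simp: twist_def mod_simps)

text \<open>The position \<open>t = i p + x\<close> is in row \<open>i\<close>, where the cycle follows the \<open>i\<close>-th image of the path
  \<open>0, p - 1, p - 2, \<dots>, 1\<close> through the columns; this order makes the path start in column \<open>0\<close>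
  and end in column \<open>1\<close>, the image of \<open>0\<close> under the twist. Both row and column change under
  the shift \<open>t \<mapsto> t + p\<close> by injective maps, so the shift preserves adjacency.\<close>

lemma rook_graph_symmetric_hamilton_cycle:
  assumes cop: "coprime k p" and k: "2 \<le> k" and p: "k < p"
  shows "\<exists>C. hamilton_cycle (rook_graph k p) C \<and> symmetric_cycle (rook_graph k p) C k"
proof -
  define N where "N = k * p"
  define row where "row t = t div p" for t
  define col where "col t = twist k (t div p) ((p - t mod p) mod p)" for t
  have p0: "0 < p" and N0: "0 < N" using k p by (auto simp: N_def)
  have row_less: "row t < k" if "t < N" for t
    using that by (simp add: row_def N_def less_mult_imp_div_less)
  have col_less: "col t < p" for t
    unfolding col_def using p p0 by (intro twist_less) auto
  have "\<exists>x. x < N \<and> x mod k = row t \<and> x mod p = col t" if "t < N" for t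
    using binary_chinese_remainder_unique_nat[OF cop, of "row t" "col t"] row_less[OF that]
      col_less[of t] k p0 by (auto simp: cong_def N_def)
  then obtain f where f: "\<And>t. t < N \<Longrightarrow> f t < N" "\<And>t. t < N \<Longrightarrow> f t mod k = row t"
      "\<And>t. t < N \<Longrightarrow> f t mod p = col t"
    by metis
  have neg_inj: "x = y" if "(p - x) mod p = (p - y) mod p" "x < p" "y < p" for x y
    using that by (cases "x = 0"; cases "y = 0") auto
  have inj: "inj_on f {..<N}"
  proof (rule inj_onI)
    fix t t' assume t: "t \<in> {..<N}" "t' \<in> {..<N}" "f t = f t'"
    then have r: "t div p = t' div p" using f(2)[of t] f(2)[of t'] by (simp add: row_def)
    have "col t = col t'" using f(3)[of t] f(3)[of t'] t by simp
    then have "(p - t mod p) mod p = (p - t' mod p) mod p"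
      unfolding col_def r by (rule twist_inj)
    then have "t mod p = t' mod p" by (rule neg_inj) (use p0 in auto)
    then have "t div p * p + t mod p = t' div p * p + t' mod p" using r by (simp only:)
    then show "t = t'" by (simp only: div_mult_mod_eq)
  qed
  have bij: "bij_betw f {..<N} {..<N}"
  proof -
    have "f ` {..<N} = {..<N}" using f(1) by (intro endo_inj_surj inj) auto
    then show ?thesis using inj by (simp add: bij_betw_def)
  qed
  define C where "C = map f [0..<N]"
  have len: "length C = N" by (simp add: C_def)
  have nth: "C ! t = f t" if "t < N" for t using that by (simp add: C_def)
  have adj: "(f s, f t) \<in> parcs (rook_graph k p) \<longleftrightarrow> s \<noteq> t \<and> (row s = row t \<or> col s = col t)"
    if "s < N" "t < N" for s t
  proof -
    have "f s = f t \<longleftrightarrow> s = t" using inj that by (simp add: inj_on_eq_iff)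
    then show ?thesis using that f by (simp add: N_def[symmetric])
  qed
  have ham: "hamilton_cycle (rook_graph k p) C"
    unfolding hamilton_cycle_def
  proof (intro conjI allI impI)
    show "distinct C" using inj by (simp add: C_def distinct_map atLeast0LessThan)
    show "set C = pverts (rook_graph k p)"
      using bij by (simp add: C_def atLeast0LessThan bij_betw_def N_def)
    have "2 * 2 \<le> N" unfolding N_def using k p by (intro mult_le_mono) auto
    then show "3 \<le> length C" using len by simp
    fix t assume "t < length C"
    then have t: "t < N" using len by simp
    define t' where "t' = (t + 1) mod N"
    have t': "t' < N" using N0 by (simp add: t'_def)
    have ne: "t \<noteq> t'" using t \<open>2 * 2 \<le> N\<close> by (cases "t + 1 = N") (auto simp: t'_def)
    \<comment> \<open>Within a row the row is shared; at the last cell of a row the cycle drops to the next row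
      in the same column, also when it closes up from row \<open>k - 1\<close> to row \<open>0\<close>.\<close>
    have "row t = row t' \<or> col t = col t'"
    proof (cases "Suc (t mod p) = p")
      case False
      then have d: "Suc t div p = t div p" by (simp add: div_Suc mod_Suc)
      have "Suc t \<noteq> N"
      proof
        assume "Suc t = N"
        then have "Suc t mod p = 0" by (simp add: N_def)
        then show False using False by (simp add: mod_Suc split: if_splits)
      qed
      then have "t' = Suc t" using t by (simp add: t'_def)
      then show ?thesis using d by (simp add: row_def)
    next
      case True
      then have y: "p - t mod p = 1" by simp
      have m: "Suc t mod p = 0" using True by (simp add: mod_Suc)
      have d: "Suc t div p = Suc (t div p)" using True by (simp add: div_Suc mod_Suc)
      have c: "col t = Suc (t div p) mod k" using k p y by (simp add: col_def twist_def)
      have "col t' = Suc (t div p) mod k"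
      proof (cases "Suc t = N")
        case True
        then have "Suc (t div p) = k" using d p0 by (simp add: N_def)
        then show ?thesis using True k by (simp add: t'_def col_def twist_def)
      next
        case False
        then have "t' = Suc t" using t by (simp add: t'_def)
        then show ?thesis using m d k by (simp add: col_def twist_def)
      qed
      then show ?thesis using c by simp
    qed
    then show "(C ! t, C ! ((t + 1) mod length C)) \<in> parcs (rook_graph k p)"
      using adj[OF t t'] ne nth t t' by (simp add: len t'_def)
  qed
  define \<tau> where "\<tau> t = (t + p) mod N" for t
  have \<tau>_less: "\<tau> t < N" for t using N0 by (simp add: \<tau>_def)
  have \<tau>_inj: "s = t" if "\<tau> s = \<tau> t" "s < N" "t < N" for s t
  proof -
    have "[s + p = t + p] (mod N)" using that by (simp add: \<tau>_def cong_def)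
    then show ?thesis using that unfolding cong_add_rcancel_nat by (simp add: cong_def)
  qed
  have \<tau>_div: "\<tau> t div p = Suc (t div p) mod k" for t
  proof -
    have "(t + p) mod (p * k) = p * ((t + p) div p mod k) + (t + p) mod p"
      by (rule mod_mult2_eq)
    then show ?thesis using p0 by (simp add: \<tau>_def N_def mult.commute[of k p])
  qed
  have \<tau>_mod: "\<tau> t mod p = t mod p" for t
    by (simp add: \<tau>_def N_def mod_mod_cancel)
  have row_\<tau>: "row (\<tau> s) = row (\<tau> t) \<longleftrightarrow> row s = row t" if "s < N" "t < N" for s t
  proof -
    have "Suc i mod k = Suc j mod k \<longleftrightarrow> i = j" if "i < k" "j < k" for i j
      using that by (auto simp: mod_Suc)
    then show ?thesis using row_less that by (simp add: row_def \<tau>_div)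
  qed
  have col_\<tau>: "col (\<tau> t) = twist k 1 (col t)" for t
    using twist_add[of k 1 "t div p"] k by (simp add: col_def \<tau>_div \<tau>_mod twist_mod)
  define \<alpha> where "\<alpha> x = f (\<tau> (inv_into {..<N} f x))" for x
  have \<alpha>: "\<alpha> (f t) = f (\<tau> t)" if "t < N" for t
    using that inj by (simp add: \<alpha>_def inv_into_f_f)
  have im: "f ` {..<N} = {..<N}" using bij by (simp add: bij_betw_def)
  have aut: "graph_automorphism (rook_graph k p) \<alpha>"
    unfolding graph_automorphism_def pverts_rook_graph N_def[symmetric]
  proof (intro conjI ballI)
    have inj\<alpha>: "inj_on \<alpha> {..<N}"
    proof (rule inj_onI)
      fix x y assume xy: "x \<in> {..<N}" "y \<in> {..<N}" "\<alpha> x = \<alpha> y"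
      then obtain s t where st: "x = f s" "s < N" "y = f t" "t < N"
        using im by (metis imageE lessThan_iff)
      then have "\<tau> s = \<tau> t" using xy \<alpha> inj \<tau>_less by (auto dest!: inj_onD)
      then show "x = y" using st \<tau>_inj[of s t] by simp
    qed
    moreover have "\<alpha> ` {..<N} \<subseteq> {..<N}"
      using f(1) \<tau>_less by (auto simp: \<alpha>_def)
    ultimately show "bij_betw \<alpha> {..<N} {..<N}"
      by (simp add: bij_betw_def endo_inj_surj)
    fix x y assume "x \<in> {..<N}" "y \<in> {..<N}"
    then obtain s t where st: "x = f s" "s < N" "y = f t" "t < N"
      using im by (metis imageE lessThan_iff)
    show "(\<alpha> x, \<alpha> y) \<in> parcs (rook_graph k p) \<longleftrightarrow> (x, y) \<in> parcs (rook_graph k p)"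
      using st adj[OF \<tau>_less \<tau>_less, of s t] adj[of s t] row_\<tau>[of s t] \<tau>_inj[of s t]
        twist_inj[of k 1 "col s" "col t"]
      by (auto simp: \<alpha> col_\<tau>)
  qed
  have "N div k = p" using k by (simp add: N_def)
  then have "symmetric_cycle (rook_graph k p) C k"
    unfolding symmetric_cycle_def len using k aut \<alpha> nth N0
    by (intro conjI exI[of _ \<alpha>]) (auto simp: N_def \<tau>_def)
  with ham show ?thesis by blast
qed

section \<open>The Hamilton compression of rook's graphs\<close>

lemma hamilton_compression_rook_graph:
  assumes p: "prime p" "k < p" and k: "2 \<le> k"
  shows "hamilton_compression (rook_graph k p) = k"
proof -
  let ?X = "rook_graph k p"
  have "coprime k p" using p k by (intro coprime_less_prime) auto
  then obtain C where C: "hamilton_cycle ?X C" "symmetric_cycle ?X C k"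
    using rook_graph_symmetric_hamilton_cycle k p by blast
  have le: "compression_factor ?X D \<le> k" if "hamilton_cycle ?X D" for D
    unfolding compression_factor_def
    using finite_symmetric_cycle[OF that] symmetric_cycle_one[OF that]
      symmetric_cycle_rook_graph_le[OF p k that]
    by (subst Max_le_iff) auto
  have "k \<le> compression_factor ?X C"
    unfolding compression_factor_def using finite_symmetric_cycle[OF C(1)] C(2)
    by (intro Max_ge) auto
  then have "compression_factor ?X C = k" using le[OF C(1)] by simp
  then have "Max {compression_factor ?X D | D. hamilton_cycle ?X D} = k"
    using C(1) le finite_compression_factors by (intro Max_eqI) (auto intro!: exI[of _ C])
  then show ?thesis unfolding hamilton_compression_def using C(1) by auto
qed

theorem corollary2p4:
  fixes k :: nat
  assumes "k \<ge> 2"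
  shows "\<exists>F :: nat pair_pre_digraph set.
           infinite F \<and>
           (\<forall>X\<in>F. is_cayley_graph X \<and> hamilton_compression X = k) \<and>
           (\<forall>X\<in>F. \<forall>Y\<in>F. X \<noteq> Y \<longrightarrow> \<not> digraph_iso (with_proj X) (with_proj Y))"
proof (intro exI conjI ballI impI)
  define P where "P = {p::nat. prime p \<and> k < p}"
  let ?F = "rook_graph k ` P"
  have "infinite P"
    unfolding infinite_nat_iff_unbounded P_def using bigger_prime
    by (metis (mono_tags, lifting) mem_Collect_eq max_less_iff_conj)
  moreover have "inj_on (rook_graph k) P"
  proof (rule inj_onI)
    fix p q assume "rook_graph k p = rook_graph k q"
    then have "{..<k * p} = {..<k * q}" by (metis pverts_rook_graph)
    then show "p = q" using assms by (simp add: lessThan_eq_iff)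
  qed
  ultimately show "infinite ?F" by (simp add: finite_image_iff)
  have cayley: "is_cayley_graph X" if "X \<in> ?F" for X
    using that assms is_cayley_graph_rook_graph[of k] by (auto simp: P_def)
  then show "is_cayley_graph X" if "X \<in> ?F" for X using that .
  show "hamilton_compression X = k" if "X \<in> ?F" for X
    using that assms hamilton_compression_rook_graph by (auto simp: P_def)
  show "\<not> digraph_iso (with_proj X) (with_proj Y)" if XY: "X \<in> ?F" "Y \<in> ?F" "X \<noteq> Y" for X Y
  proof
    assume "digraph_iso (with_proj X) (with_proj Y)"
    then obtain \<alpha> where "bij_betw \<alpha> (pverts X) (pverts Y)"
      using digraph_iso_with_proj_iff[of X Y] cayley XY is_cayley_graph_imp_pair_graph by blast
    then have "card (pverts X) = card (pverts Y)" by (rule bij_betw_same_card)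
    then show False using XY assms by auto
  qed
qed

end
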